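(* Let $d\ge1$, $a>0$, $b\in\mathbb{R}^d$. If $D\subset\mathbb{R}^d$ is a nonempty bounded open set and $u:\overline D\to\mathbb{R}$ is harmonic in $D$ (with respect to $a,b$) and continuous in $\overline D$, then $$\sup_{x\in\overline D}u(x)=\sup_{x\in\partial D}u(x).$$
   Context: Harmonic: $u$ is harmonic in $D$ if $u$ is of class $C^2$ in $D$ and $a\Delta u(x)+b\cdot\nabla u(x)=0$ for all $x\in D$. $\overline D$ and $\partial D$ denote the closure and the boundary of $D$. *)

theory Defs
  imports "HOL-Analysis.Analysis"
begin

definition partial_deriv :: "'n::finite \<Rightarrow> (real^'n \<Rightarrow> real) \<Rightarrow> real^'n \<Rightarrow> real" where
  "partial_deriv i f x = deriv (\<lambda>t. f (x + t *\<^sub>R axis i 1)) 0"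

text \<open>The following two notions are meant for open \<open>D\<close>, where they only depend on the values of
  \<open>f\<close> on \<open>D\<close>: all partial derivatives up to the given order exist and are continuous on \<open>D\<close>.\<close>

definition C1_on :: "(real^'n::finite) set \<Rightarrow> (real^'n \<Rightarrow> real) \<Rightarrow> bool" where
  "C1_on D f \<longleftrightarrow> continuous_on D f \<and>
     (\<forall>i. (\<forall>x\<in>D. (\<lambda>t. f (x + t *\<^sub>R axis i 1)) differentiable (at 0)) \<and>
          continuous_on D (partial_deriv i f))"

definition C2_on :: "(real^'n::finite) set \<Rightarrow> (real^'n \<Rightarrow> real) \<Rightarrow> bool" where
  "C2_on D f \<longleftrightarrow> C1_on D f \<and> (\<forall>i. C1_on D (partial_deriv i f))"

definition gradient :: "(real^'n::finite \<Rightarrow> real) \<Rightarrow> real^'n \<Rightarrow> real^'n" where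
  "gradient f x = (\<chi> i. partial_deriv i f x)"

definition laplacian :: "(real^'n::finite \<Rightarrow> real) \<Rightarrow> real^'n \<Rightarrow> real" where
  "laplacian f x = (\<Sum>i\<in>UNIV. partial_deriv i (partial_deriv i f) x)"

definition harmonic_on :: "real \<Rightarrow> real^'n::finite \<Rightarrow> (real^'n) set \<Rightarrow> (real^'n \<Rightarrow> real) \<Rightarrow> bool" where
  "harmonic_on a b D u \<longleftrightarrow>
     C2_on D u \<and> (\<forall>x\<in>D. a * laplacian u x + b \<bullet> gradient u x = 0)"

end

theory Submission
  imports Defs
begin

text \<open>Perturbation: for a coordinate \<open>k\<close> and a sign \<open>l = \<plusminus>1\<close> with \<open>l * b $ k \<ge> 0\<close>, the function
  \<open>h x = exp (l * x $ k)\<close> satisfies \<open>a \<Delta>h + b \<bullet> \<nabla>h > 0\<close>. Hence \<open>u + \<epsilon> h\<close> has no maximum in the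
  interior, where the gradient would vanish and all pure second derivatives would be at most \<open>0\<close>.
  So it attains its maximum on the frontier, and \<open>\<epsilon> \<rightarrow> 0\<close> gives the claim for \<open>u\<close>.\<close>

text \<open>If \<open>l\<close> were positive, \<open>f'\<close> would increase through its zero at
  \<open>c\<close>, so \<open>f'\<close> would be positive just to the right of \<open>c\<close>;
  the mean value theorem would then give a value of \<open>f\<close> there exceeding
  \<open>f c\<close>.\<close>

lemma local_max_second_derivative:
  fixes f f' :: "real \<Rightarrow> real"
  assumes "e > 0"
    and deriv: "\<And>t. \<bar>t - c\<bar> < e \<Longrightarrow> (f has_real_derivative f' t) (at t)"
    and deriv2: "(f' has_real_derivative l) (at c)"
    and max: "\<And>t. \<bar>t - c\<bar> < e \<Longrightarrow> f t \<le> f c"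
  shows "f' c = 0" and "l \<le> 0"
proof -
  show crit: "f' c = 0"
    using DERIV_local_max[OF deriv \<open>e > 0\<close>] max \<open>e > 0\<close> by (simp add: abs_minus_commute)
  show "l \<le> 0"
  proof (rule ccontr)
    assume "\<not> l \<le> 0"
    then obtain d where d: "d > 0" "\<And>h. h > 0 \<Longrightarrow> h < d \<Longrightarrow> f' c < f' (c + h)"
      using DERIV_pos_inc_right[OF deriv2] by auto
    define s where "s = min d e / 2"
    have s: "s > 0" "s < d" "s < e"
      using d(1) \<open>e > 0\<close> by (auto simp: s_def)
    obtain z where z: "c < z" "z < c + s" "f (c + s) - f c = (c + s - c) * f' z"
      using MVT2[of c "c + s" f f'] s deriv by auto
    have "f' z > 0"
      using d(2)[of "z - c"] z s crit by simp
    then have "f (c + s) > f c"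
      using z(3) s(1) by (metis add_diff_cancel_left' diff_gt_0_iff_gt mult_pos_pos)
    then show False
      using max[of "c + s"] s by simp
  qed
qed

text \<open>\<open>partial_deriv\<close> differentiates at parameter 0 of a line through its base
  point. Shifting the parameter by \<open>s\<close> turns this into a derivative at every point of
  one fixed line, so that one-variable calculus applies along it.\<close>

lemma has_partial_deriv_along_axis:
  fixes f :: "real^'n::finite \<Rightarrow> real"
  assumes "C1_on D f" and "x + s *\<^sub>R axis i 1 \<in> D"
  shows "((\<lambda>t. f (x + t *\<^sub>R axis i 1)) has_real_derivative
           partial_deriv i f (x + s *\<^sub>R axis i 1)) (at s)"
proof -
  have "(\<lambda>t. f ((x + s *\<^sub>R axis i 1) + t *\<^sub>R axis i 1)) differentiable (at 0)"
    using assms unfolding C1_on_def by blast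
  then have "((\<lambda>t. f ((x + s *\<^sub>R axis i 1) + t *\<^sub>R axis i 1)) has_real_derivative
      partial_deriv i f (x + s *\<^sub>R axis i 1)) (at 0)"
    unfolding partial_deriv_def
    by (simp add: DERIV_deriv_iff_real_differentiable)
  then have "((\<lambda>t. f (x + (t + s) *\<^sub>R axis i 1)) has_real_derivative
      partial_deriv i f (x + s *\<^sub>R axis i 1)) (at 0)"
    by (simp add: algebra_simps)
  then show ?thesis
    using DERIV_shift[of "\<lambda>t. f (x + t *\<^sub>R axis i 1)" _ 0 s] by simp
qed

lemma perturbed_harmonic_no_interior_max:
  fixes b :: "real^'n::finite"
  assumes "a > 0" and "open D" and harm: "harmonic_on a b D u"
    and "\<epsilon> > 0" and l: "l * l = 1" "l * b $ k \<ge> 0" and "x \<in> D"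
  shows "\<exists>y\<in>D. u x + \<epsilon> * exp (l * x $ k) < u y + \<epsilon> * exp (l * y $ k)"
proof (rule ccontr)
  assume neg: "\<not> ?thesis"
  define v where "v = (\<lambda>y. u y + \<epsilon> * exp (l * y $ k))"
  have max: "v y \<le> v x" if "y \<in> D" for y
    using neg that by (force simp: v_def not_less)
  define E where "E = \<epsilon> * exp (l * x $ k)"
  have "E > 0" using \<open>\<epsilon> > 0\<close> by (simp add: E_def)
  obtain e where e: "e > 0" "ball x e \<subseteq> D"
    using \<open>open D\<close> \<open>x \<in> D\<close> open_contains_ball by blast
  have C1: "C1_on D u" "\<And>i. C1_on D (partial_deriv i u)"
    and pde: "a * laplacian u x + b \<bullet> gradient u x = 0"
    using harm \<open>x \<in> D\<close> by (auto simp: harmonic_on_def C2_on_def)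
  \<comment> \<open>The perturbation has value \<open>E\<close> at \<open>x\<close>; its first and
    second derivatives along axis \<open>k\<close> are \<open>l * E\<close> and
    \<open>l * l * E = E\<close>, and those along other axes vanish. The maximum conditions for
    \<open>v\<close> thus become conditions on \<open>u\<close>.\<close>
  have first_second: "partial_deriv i u x = - (if i = k then l * E else 0) \<and>
      partial_deriv i (partial_deriv i u) x \<le> - (if i = k then E else 0)" for i
  proof -
    \<comment> \<open>\<open>m\<close> is the slope of the exponent along axis \<open>i\<close>, so
      a single formula \<open>p\<close> covers both \<open>i = k\<close> and
      \<open>i \<noteq> k\<close>.\<close>
    define m where "m = (if i = k then l else 0)"
    define p where "p = (\<lambda>t. \<epsilon> * exp (l * x $ k + m * t))"
    have inD: "x + t *\<^sub>R axis i 1 \<in> D" if "\<bar>t - 0\<bar> < e" for t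
      using that e(2) by (auto simp: dist_norm subset_iff)
    have p: "(p has_real_derivative m * p t) (at t)" for t
      unfolding p_def by (auto intro!: derivative_eq_intros)
    have v: "v (x + t *\<^sub>R axis i 1) = u (x + t *\<^sub>R axis i 1) + p t" for t
      by (simp add: v_def p_def m_def axis_def algebra_simps)
    have 1: "((\<lambda>t. v (x + t *\<^sub>R axis i 1)) has_real_derivative
        partial_deriv i u (x + t *\<^sub>R axis i 1) + m * p t) (at t)" if "\<bar>t - 0\<bar> < e" for t
      unfolding v using has_partial_deriv_along_axis[OF C1(1) inD[OF that]] p
      by (rule DERIV_add)
    have "((\<lambda>t. partial_deriv i u (x + t *\<^sub>R axis i 1)) has_real_derivative
        partial_deriv i (partial_deriv i u) (x + 0 *\<^sub>R axis i 1)) (at 0)"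
      using e(1) by (intro has_partial_deriv_along_axis[OF C1(2)] inD) simp
    then have 2: "((\<lambda>t. partial_deriv i u (x + t *\<^sub>R axis i 1) + m * p t) has_real_derivative
        partial_deriv i (partial_deriv i u) x + m * (m * p 0)) (at 0)"
      using DERIV_add DERIV_cmult[OF p] by fastforce
    have 3: "v (x + t *\<^sub>R axis i 1) \<le> v (x + 0 *\<^sub>R axis i 1)" if "\<bar>t - 0\<bar> < e" for t
      using max[OF inD[OF that]] by simp
    have "p 0 = E"
      by (simp add: p_def E_def)
    moreover have "m * (m * p 0) = (if i = k then p 0 else 0)"
      using l(1) by (simp add: m_def flip: mult.assoc)
    ultimately show ?thesis
      using local_max_second_derivative[OF e(1) 1 2 3] by (auto simp: m_def)
  qed
  have "laplacian u x \<le> (\<Sum>i\<in>UNIV. - (if i = k then E else 0))"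
    unfolding laplacian_def using first_second by (intro sum_mono) blast
  also have "\<dots> = - E"
    by (simp add: sum_negf)
  finally have lap: "a * laplacian u x \<le> a * - E"
    using \<open>a > 0\<close> by (intro mult_left_mono) auto
  have "b \<bullet> gradient u x = (\<Sum>i\<in>UNIV. if i = k then - (b $ i * (l * E)) else 0)"
    unfolding inner_vec_def gradient_def using first_second by (intro sum.cong) auto
  also have "\<dots> = - (l * b $ k * E)"
    by simp
  \<comment> \<open>The sign of \<open>l\<close> makes the drift contribution at most 0, while the
    diffusion contributes at most \<open>- (a * E) < 0\<close>; the sum cannot be 0.\<close>
  finally have "a * laplacian u x + b \<bullet> gradient u x \<le> - (a * E) - l * b $ k * E"
    using lap by simp
  moreover have "a * E > 0" "l * b $ k * E \<ge> 0"
    using \<open>a > 0\<close> \<open>E > 0\<close> l(2) by simp_all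
  ultimately show False
    using pde by linarith
qed

lemma harmonic_le_frontier_bound:
  fixes b :: "real^'n::finite"
  assumes "a > 0" and "bounded D" and "open D" and "harmonic_on a b D u"
    and cont: "continuous_on (closure D) u"
    and bound: "\<And>y. y \<in> frontier D \<Longrightarrow> u y \<le> m" and "x \<in> D"
  shows "u x \<le> m"
proof -
  \<comment> \<open>Any coordinate will do; one exists because types are nonempty, which is the
    condition that the dimension is at least 1.\<close>
  fix k :: 'n
  define l :: real where "l = (if b $ k \<ge> 0 then 1 else - 1)"
  have l: "l * l = 1" "l * b $ k \<ge> 0"
    by (auto simp: l_def)
  define h where "h = (\<lambda>y::real^'n. exp (l * y $ k))"
  have compact: "compact (closure D)"
    using \<open>bounded D\<close> by (rule compact_closure[THEN iffD2])
  have xcl: "x \<in> closure D"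
    using \<open>x \<in> D\<close> closure_subset by blast
  have h_cont: "continuous_on (closure D) h"
    unfolding h_def by (intro continuous_intros)
  have ne: "closure D \<noteq> {}"
    using \<open>x \<in> D\<close> by auto
  obtain z where z: "\<And>y. y \<in> closure D \<Longrightarrow> h y \<le> h z"
    using continuous_attains_sup[OF compact ne h_cont] by blast
  have hz: "h z > 0" by (simp add: h_def)
  show ?thesis
  proof (rule field_le_epsilon)
    fix d :: real assume "d > 0"
    \<comment> \<open>With \<open>h z\<close> the maximum of \<open>h\<close>, this makes the
      perturbation at most \<open>d\<close> on the whole closure.\<close>
    define \<epsilon> where "\<epsilon> = d / h z"
    have \<epsilon>: "\<epsilon> > 0" "\<epsilon> * h z = d"
      using \<open>d > 0\<close> hz by (simp_all add: \<epsilon>_def)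
    have "continuous_on (closure D) (\<lambda>y. u y + \<epsilon> * h y)"
      by (intro continuous_intros cont h_cont)
    then obtain y where y: "y \<in> closure D"
        "\<And>w. w \<in> closure D \<Longrightarrow> u w + \<epsilon> * h w \<le> u y + \<epsilon> * h y"
      using continuous_attains_sup[OF compact ne] by blast
    have "y \<notin> D"
    proof
      assume "y \<in> D"
      then obtain w where "w \<in> D" "u y + \<epsilon> * h y < u w + \<epsilon> * h w"
        using perturbed_harmonic_no_interior_max[OF assms(1,3,4) \<epsilon>(1) l] unfolding h_def by blast
      then show False
        using y(2)[of w] closure_subset by fastforce
    qed
    then have "y \<in> frontier D"
      using y(1) \<open>open D\<close> by (simp add: frontier_def interior_open)
    have "u x \<le> u x + \<epsilon> * h x"
      using \<epsilon>(1) by (simp add: h_def)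
    also have "\<dots> \<le> u y + \<epsilon> * h y"
      using y(2) xcl by blast
    also have "\<dots> \<le> m + \<epsilon> * h z"
      using bound[OF \<open>y \<in> frontier D\<close>] z[OF y(1)] \<epsilon>(1) by (intro add_mono) auto
    finally show "u x \<le> m + d"
      using \<epsilon>(2) by simp
  qed
qed

theorem corollary3p8:
  fixes a :: real and b :: "real^'n::finite"
    and D :: "(real^'n) set" and u :: "real^'n \<Rightarrow> real"
  assumes "a > 0"
    and "D \<noteq> {}" and "bounded D" and "open D"
    and "harmonic_on a b D u"
    and "continuous_on (closure D) u"
  shows "(SUP x\<in>closure D. u x) = (SUP x\<in>frontier D. u x)"
proof (rule antisym)
  have "compact (closure D)"
    using assms(3) by (rule compact_closure[THEN iffD2])
  then have bdd: "bdd_above (u ` closure D)"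
    using assms(6) by (intro bounded_imp_bdd_above compact_imp_bounded compact_continuous_image)
  have sub: "frontier D \<subseteq> closure D"
    by (auto simp: frontier_def)
  have upper: "u y \<le> (SUP x\<in>frontier D. u x)" if "y \<in> frontier D" for y
    using that bdd_above_mono[OF bdd image_mono[OF sub]] by (intro cSUP_upper)
  \<comment> \<open>By connectedness of the space, only the empty set and \<open>UNIV\<close> have
    empty frontier. A nonempty frontier is needed for the right-hand supremum to be
    meaningful.\<close>
  have "D \<noteq> UNIV"
    using assms(3) not_bounded_UNIV by auto
  then have "frontier D \<noteq> {}"
    using assms(2) frontier_eq_empty by blast
  then show "(SUP x\<in>frontier D. u x) \<le> (SUP x\<in>closure D. u x)"
    using bdd sub by (intro cSUP_subset_mono) auto
  show "(SUP x\<in>closure D. u x) \<le> (SUP x\<in>frontier D. u x)"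
  proof (rule cSUP_least)
    fix x assume "x \<in> closure D"
    then consider "x \<in> D" | "x \<in> frontier D"
      using assms(4) by (auto simp: frontier_def interior_open)
    then show "u x \<le> (SUP x\<in>frontier D. u x)"
      using harmonic_le_frontier_bound[OF assms(1,3-6) upper] upper by cases auto
  qed (use assms(2) in simp)
qed

end
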